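(* The HSD problem with models $\mathcal M_0,\dots,\mathcal M_K$ and maximum parameter value $\overline T$ can be solved (i.e., a minimizing hierarchy $(\sigma,T)$ and its latency can be found) in time $O\big(\overline T^4K^4\log(\overline T K)\big)$.
   Context: HSD problem (with maximum parameter value $\overline T\in\mathbb N$). Input: costs $c_0,\dots,c_K>0$ of models $\mathcal M_0,\dots,\mathcal M_K$ and pairwise acceptance rates $\alpha_{i,j}\in[0,1]$; $\mathcal M_K$ is the target model. A hierarchy is a pair $(\sigma,T)$ with $\sigma=(\sigma[0]<\dots<\sigma[m])$ an ordered subset of $\{0,\dots,K\}$, $m\ge1$, $\sigma[m]=K$, and $T=(T_0,\dots,T_{m-1})\in\{1,\dots,\overline T\}^m$. Its latency is $$L(\sigma,T)=\sum_{i=0}^{m} c_{\sigma[i]}\prod_{j=i}^{m} R_{j},\quad R_m=\frac{1-\alpha}{1-\alpha^{T_{m-1}+1}}\ \text{with } \alpha=\alpha_{\sigma[m-1],\sigma[m]},\quad R_j=\gamma(\alpha_{\sigma[j-1],\sigma[j]},T_{j-1},T_j)\ (1\le j<m),\quad R_0=T_0.$$ The problem asks for a hierarchy attaining $L^*=\min_{\sigma,T}L(\sigma,T)$. For $\alpha=1$, $(1-\alpha)/(1-\alpha^{t+1})$ is read as $1/(t+1)$. For $\alpha\in[0,1]$ and positive integers $a,b$, $\gamma(\alpha,a,b)=\mathbb E[\min\{r\ge1: N_1+\dots+N_r\ge b\}]$, where $N_1,N_2,\dots$ are i.i.d. copies of $1+G$ and $G$ is the number of successes before the first failure among $a$ independent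 trials of success probability $\alpha$ (so $\mathbb P(G\ge g)=\alpha^g$ for $0\le g\le a$). Running time is the number of elementary steps, with arithmetic operations and comparisons on real numbers counted as one step each. *)

theory Defs
  imports "HOL-Probability.Probability"
begin

section \<open>Hierarchies and their latency\<close>

text \<open>
  The law of \<open>N = 1 + G\<close>: the leading block of successes in \<open>a\<close> independent Bernoulli trials
  has length \<open>G\<close>, which equals \<open>a\<close> if no trial fails.
\<close>

definition round_pmf :: "real \<Rightarrow> nat \<Rightarrow> nat pmf" where
  "round_pmf \<alpha> a =
     map_pmf (\<lambda>xs. 1 + length (takeWhile (\<lambda>x. x) xs)) (replicate_pmf a (bernoulli_pmf \<alpha>))"

text \<open>
  The coordinates of \<open>stream_space (measure_pmf p)\<close> are the canonical i.i.d. sequence with law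
  \<open>p\<close>; the coordinate \<open>\<omega> !! i\<close> is \<open>N\<close> with index \<open>i + 1\<close>.
\<close>

definition gamma_rounds :: "real \<Rightarrow> nat \<Rightarrow> nat \<Rightarrow> real" where
  "gamma_rounds \<alpha> a b =
     (\<integral>\<omega>. real (LEAST r. 1 \<le> r \<and> b \<le> (\<Sum>i<r. \<omega> !! i)) \<partial>stream_space (measure_pmf (round_pmf \<alpha> a)))"

definition target_factor :: "real \<Rightarrow> nat \<Rightarrow> real" where
  "target_factor \<alpha> t = (if \<alpha> = 1 then 1 / (real t + 1) else (1 - \<alpha>) / (1 - \<alpha> ^ (t + 1)))"

text \<open>A hierarchy \<open>(\<sigma>, \<tau>)\<close> with \<open>m = length \<tau>\<close>.\<close>

type_synonym hierarchy = "nat list \<times> nat list"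

definition hierarchies :: "nat \<Rightarrow> nat \<Rightarrow> hierarchy set" where
  "hierarchies K Tmax =
     {(\<sigma>, \<tau>). length \<tau> \<ge> 1 \<and> length \<sigma> = length \<tau> + 1 \<and>
              sorted_wrt (<) \<sigma> \<and> set \<sigma> \<subseteq> {0..K} \<and> \<sigma> ! length \<tau> = K \<and>
              set \<tau> \<subseteq> {1..Tmax}}"

definition hier_factor :: "(nat \<Rightarrow> nat \<Rightarrow> real) \<Rightarrow> hierarchy \<Rightarrow> nat \<Rightarrow> real" where
  "hier_factor \<alpha> = (\<lambda>(\<sigma>, \<tau>) j.
     if j = 0 then real (\<tau> ! 0)
     else if j < length \<tau> then gamma_rounds (\<alpha> (\<sigma> ! (j - 1)) (\<sigma> ! j)) (\<tau> ! (j - 1)) (\<tau> ! j)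
     else target_factor (\<alpha> (\<sigma> ! (j - 1)) (\<sigma> ! j)) (\<tau> ! (j - 1)))"

definition latency :: "(nat \<Rightarrow> real) \<Rightarrow> (nat \<Rightarrow> nat \<Rightarrow> real) \<Rightarrow> hierarchy \<Rightarrow> real" where
  "latency c \<alpha> = (\<lambda>(\<sigma>, \<tau>).
     \<Sum>i=0..length \<tau>. c (\<sigma> ! i) * (\<Prod>j=i..length \<tau>. hier_factor \<alpha> (\<sigma>, \<tau>) j))"

definition hsd_instance :: "nat \<Rightarrow> nat \<Rightarrow> (nat \<Rightarrow> real) \<Rightarrow> (nat \<Rightarrow> nat \<Rightarrow> real) \<Rightarrow> bool" where
  "hsd_instance K Tmax c \<alpha> \<longleftrightarrow>
     K \<ge> 1 \<and> Tmax \<ge> 1 \<and> (\<forall>i\<le>K. c i > 0) \<and> (\<forall>i\<le>K. \<forall>j\<le>K. \<alpha> i j \<in> {0..1})"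


section \<open>A real random access machine\<close>

text \<open>
  The running time refers to structured programs over two kinds of arrays, holding natural numbers
  and real numbers respectively. A program mentions only finitely many array names; a scalar
  variable is an array used at index 0. Real arithmetic and comparison are exact and cost one step
  each. Only natural numbers can be used as addresses, they support only addition, truncated
  subtraction and comparison, and there is no rounding from reals to natural numbers: with unit
  cost, rounding would be an unreasonably powerful operation. For the same reason there are no
  real constants other than the images of natural numbers: an arbitrary one could encode
  infinitely much information.
\<close>

type_synonym state = "(string \<Rightarrow> nat \<Rightarrow> nat) \<times> (string \<Rightarrow> nat \<Rightarrow> real)"

datatype nexp =
    NConst nat
  | NCell string nexp
  | NAdd nexp nexp
  | NSub nexp nexp

datatype rexp =
    ROfNat nexp
  | RCell string nexp
  | RAdd rexp rexp
  | RSub rexp rexp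
  | RMul rexp rexp
  | RDiv rexp rexp

datatype bexp =
    NLess nexp nexp
  | RLess rexp rexp
  | BNot bexp
  | BAnd bexp bexp

datatype com =
    Skip
  | NStore string nexp nexp
  | RStore string nexp rexp
  | Seq com com
  | Cond bexp com com
  | Loop bexp com

primrec nval :: "nexp \<Rightarrow> state \<Rightarrow> nat" where
  "nval (NConst k) s = k"
| "nval (NCell x e) s = fst s x (nval e s)"
| "nval (NAdd d e) s = nval d s + nval e s"
| "nval (NSub d e) s = nval d s - nval e s"

primrec rval :: "rexp \<Rightarrow> state \<Rightarrow> real" where
  "rval (ROfNat e) s = real (nval e s)"
| "rval (RCell x e) s = snd s x (nval e s)"
| "rval (RAdd d e) s = rval d s + rval e s"
| "rval (RSub d e) s = rval d s - rval e s"
| "rval (RMul d e) s = rval d s * rval e s"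
| "rval (RDiv d e) s = rval d s / rval e s"

primrec bval :: "bexp \<Rightarrow> state \<Rightarrow> bool" where
  "bval (NLess d e) s \<longleftrightarrow> nval d s < nval e s"
| "bval (RLess d e) s \<longleftrightarrow> rval d s < rval e s"
| "bval (BNot b) s \<longleftrightarrow> \<not> bval b s"
| "bval (BAnd b b') s \<longleftrightarrow> bval b s \<and> bval b' s"

text \<open>Evaluating an expression costs one step per operation, memory access or constant.\<close>

primrec ncost :: "nexp \<Rightarrow> nat" where
  "ncost (NConst k) = 1"
| "ncost (NCell x e) = 1 + ncost e"
| "ncost (NAdd d e) = 1 + ncost d + ncost e"
| "ncost (NSub d e) = 1 + ncost d + ncost e"

primrec rcost :: "rexp \<Rightarrow> nat" where
  "rcost (ROfNat e) = 1 + ncost e"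
| "rcost (RCell x e) = 1 + ncost e"
| "rcost (RAdd d e) = 1 + rcost d + rcost e"
| "rcost (RSub d e) = 1 + rcost d + rcost e"
| "rcost (RMul d e) = 1 + rcost d + rcost e"
| "rcost (RDiv d e) = 1 + rcost d + rcost e"

primrec bcost :: "bexp \<Rightarrow> nat" where
  "bcost (NLess d e) = 1 + ncost d + ncost e"
| "bcost (RLess d e) = 1 + rcost d + rcost e"
| "bcost (BNot b) = 1 + bcost b"
| "bcost (BAnd b b') = 1 + bcost b + bcost b'"

definition nupd :: "string \<Rightarrow> nat \<Rightarrow> nat \<Rightarrow> state \<Rightarrow> state" where
  "nupd x i v s = ((fst s)(x := (fst s x)(i := v)), snd s)"

definition rupd :: "string \<Rightarrow> nat \<Rightarrow> real \<Rightarrow> state \<Rightarrow> state" where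
  "rupd x i v s = (fst s, (snd s)(x := (snd s x)(i := v)))"

text \<open>\<open>runs P s n s'\<close>: started in \<open>s\<close>, program \<open>P\<close> halts in \<open>s'\<close> after exactly \<open>n\<close> steps.\<close>

inductive runs :: "com \<Rightarrow> state \<Rightarrow> nat \<Rightarrow> state \<Rightarrow> bool" where
  Skip: "runs Skip s 1 s"
| NStore: "runs (NStore x a e) s (1 + ncost a + ncost e) (nupd x (nval a s) (nval e s) s)"
| RStore: "runs (RStore x a e) s (1 + ncost a + rcost e) (rupd x (nval a s) (rval e s) s)"
| Seq: "runs P s n s' \<Longrightarrow> runs Q s' n' s'' \<Longrightarrow> runs (Seq P Q) s (n + n') s''"
| CondTrue: "bval b s \<Longrightarrow> runs P s n s' \<Longrightarrow> runs (Cond b P Q) s (1 + bcost b + n) s'"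
| CondFalse: "\<not> bval b s \<Longrightarrow> runs Q s n s' \<Longrightarrow> runs (Cond b P Q) s (1 + bcost b + n) s'"
| LoopFalse: "\<not> bval b s \<Longrightarrow> runs (Loop b P) s (1 + bcost b) s"
| LoopTrue: "bval b s \<Longrightarrow> runs P s n s' \<Longrightarrow> runs (Loop b P) s' n' s'' \<Longrightarrow>
    runs (Loop b P) s (1 + bcost b + n + n') s''"

lemma runs_deterministic:
  assumes "runs P s n s'" and "runs P s k t"
  shows "n = k \<and> s' = t"
  using assms
proof (induction arbitrary: k t rule: runs.induct)
  case Skip
  then show ?case by (auto elim: runs.cases)
next
  case NStore
  then show ?case by (auto elim: runs.cases)
next
  case RStore
  then show ?case by (auto elim: runs.cases)
next
  case (Seq P s n s' Q n' s'')
  from Seq.prems show ?case by cases (use Seq.IH in blast)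
next
  case (CondTrue b s P n s' Q)
  from CondTrue.prems show ?case by cases (use CondTrue in blast)+
next
  case (CondFalse b s Q n s' P)
  from CondFalse.prems show ?case by cases (use CondFalse in blast)+
next
  case (LoopFalse b s P)
  from LoopFalse.prems show ?case by cases (use LoopFalse in auto)
next
  case (LoopTrue b s P n s' n' s'')
  from LoopTrue.prems show ?case by cases (use LoopTrue in blast)+
qed


section \<open>Input and output conventions\<close>

text \<open>
  The acceptance rates are stored row by row in a single array. Every cell that does not belong to
  the input holds 0, so the initial state depends on nothing but the instance.
\<close>

definition hsd_input :: "nat \<Rightarrow> nat \<Rightarrow> (nat \<Rightarrow> real) \<Rightarrow> (nat \<Rightarrow> nat \<Rightarrow> real) \<Rightarrow> state" where
  "hsd_input K Tmax c \<alpha> =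
    (\<lambda>x i. if x = ''K'' \<and> i = 0 then K
           else if x = ''Tmax'' \<and> i = 0 then Tmax
           else 0,
     \<lambda>x i. if x = ''c'' \<and> i \<le> K then c i
           else if x = ''alpha'' \<and> i < (K + 1) * (K + 1) then \<alpha> (i div (K + 1)) (i mod (K + 1))
           else 0)"

definition out_hierarchy :: "state \<Rightarrow> hierarchy" where
  "out_hierarchy s =
    (let m = fst s ''m'' 0
     in (map (fst s ''sigma'') [0..<m + 1], map (fst s ''tau'') [0..<m]))"

definition out_latency :: "state \<Rightarrow> real" where
  "out_latency s = snd s ''L'' 0"

definition hsd_solved :: "nat \<Rightarrow> nat \<Rightarrow> (nat \<Rightarrow> real) \<Rightarrow> (nat \<Rightarrow> nat \<Rightarrow> real) \<Rightarrow> state \<Rightarrow> bool" where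
  "hsd_solved K Tmax c \<alpha> s \<longleftrightarrow>
     is_arg_min (latency c \<alpha>) (\<lambda>h. h \<in> hierarchies K Tmax) (out_hierarchy s) \<and>
     out_latency s = latency c \<alpha> (out_hierarchy s)"

end

theory Submission
  imports Defs
begin

text \<open>
  Writing \<open>S i\<close> for the part of the latency sum up to index \<open>i\<close>, with the product taken only up to
  \<open>R i\<close>, one has \<open>S (i + 1) = (S i + c) * R (i + 1)\<close>, where \<open>c\<close> is the cost of the new model. The new
  factor is nonnegative and depends only on the last two pairs (model, parameter), so Bellman's
  principle applies: the least value of \<open>S\<close> over all partial hierarchies ending in a given pair is
  computed from the values at the pairs with a smaller model. There are \<open>K * T\<close> pairs, and the factor
  of each of the \<open>O(K^2 * T^2)\<close> transitions is found in \<open>O(T^2)\<close> steps by the renewal equation of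
  \<open>gamma_rounds\<close>, obtained by conditioning on the first round. Altogether \<open>O(K^2 * T^4)\<close> steps suffice.
\<close>

section \<open>The renewal equation for the mean number of rounds\<close>

text \<open>The expectation of \<open>f\<close> under \<open>round_pmf \<alpha> a\<close>, arranged
  like Horner's rule by conditioning on the first trial, so that a program can evaluate it in
  \<open>O(a)\<close> steps.\<close>

primrec round_mean :: "real \<Rightarrow> nat \<Rightarrow> (nat \<Rightarrow> real) \<Rightarrow> real" where
  "round_mean \<alpha> 0 f = f 1"
| "round_mean \<alpha> (Suc a) f = (1 - \<alpha>) * f 1 + \<alpha> * round_mean \<alpha> a (\<lambda>n. f (Suc n))"

lemma round_mean_cong:
  "(\<And>n. 1 \<le> n \<Longrightarrow> f n = g n) \<Longrightarrow> round_mean \<alpha> a f = round_mean \<alpha> a g"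
proof (induction a arbitrary: f g)
  case (Suc a)
  from Suc.IH[of "\<lambda>n. f (Suc n)" "\<lambda>n. g (Suc n)"] Suc.prems show ?case by simp
qed simp

lemma finite_set_replicate_pmf:
  assumes "finite (set_pmf p)"
  shows "finite (set_pmf (replicate_pmf n p))"
  using finite_lists_length_eq[OF assms, of n]
  by (simp add: set_replicate_pmf lists_eq_set conj_commute)

lemma finite_set_round_pmf: "finite (set_pmf (round_pmf \<alpha> a))"
  by (simp add: round_pmf_def finite_set_replicate_pmf)

lemma round_pmf_pos: "n \<in> set_pmf (round_pmf \<alpha> a) \<Longrightarrow> 1 \<le> n"
  by (auto simp: round_pmf_def)

lemma integral_round_pmf:
  assumes "\<alpha> \<in> {0..1}"
  shows "(\<integral>n. f n \<partial>measure_pmf (round_pmf \<alpha> a)) = round_mean \<alpha> a f"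
proof (induction a arbitrary: f)
  case 0
  show ?case by (simp add: round_pmf_def)
next
  case (Suc a)
  let ?B = "bernoulli_pmf \<alpha>"
  have fin: "finite (set_pmf (replicate_pmf a ?B))"
    by (intro finite_set_replicate_pmf) simp
  have "round_pmf \<alpha> (Suc a) =
      bind_pmf ?B (\<lambda>x. map_pmf (\<lambda>xs. 1 + length (takeWhile (\<lambda>x. x) (x # xs))) (replicate_pmf a ?B))"
    by (simp add: round_pmf_def map_bind_pmf map_pmf_def[symmetric] map_pmf_comp)
  also have "(\<integral>n. f n \<partial>measure_pmf \<dots>) =
      (\<Sum>x\<in>UNIV. pmf ?B x *\<^sub>R (\<integral>n. f n \<partial>measure_pmf
         (map_pmf (\<lambda>xs. 1 + length (takeWhile (\<lambda>x. x) (x # xs))) (replicate_pmf a ?B))))"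
    using fin by (intro pmf_expectation_bind) auto
  also have "\<dots> = (1 - \<alpha>) * f 1 + \<alpha> * (\<integral>n. f (Suc n) \<partial>measure_pmf (round_pmf \<alpha> a))"
    using assms by (simp add: UNIV_bool round_pmf_def)
  finally show ?case by (simp add: Suc.IH)
qed

section \<open>Hitting times of the sums of rounds\<close>

abbreviation reaches :: "nat \<Rightarrow> nat stream \<Rightarrow> nat \<Rightarrow> bool" where
  "reaches b \<omega> r \<equiv> 1 \<le> r \<and> b \<le> (\<Sum>i<r. \<omega> !! i)"

definition hitting :: "nat \<Rightarrow> nat stream \<Rightarrow> nat" where
  "hitting b \<omega> = (LEAST r. reaches b \<omega> r)"

text \<open>Each round contributes at least 1. Hence \<open>LEAST\<close> in \<open>hitting\<close>
  is attained and hitting times are bounded, which later gives integrability.\<close>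

lemma reaches_bound:
  assumes "stream_all (\<lambda>n. 1 \<le> n) \<omega>" and "1 \<le> b"
  shows "reaches b \<omega> b"
proof -
  have "(\<Sum>i<b. 1) \<le> (\<Sum>i<b. \<omega> !! i)"
    by (intro sum_mono) (use assms in \<open>auto simp: stream_all_def\<close>)
  then show ?thesis using assms by simp
qed

lemma hitting_le:
  assumes "stream_all (\<lambda>n. 1 \<le> n) \<omega>" and "1 \<le> b"
  shows "hitting b \<omega> \<le> b"
  unfolding hitting_def by (rule Least_le) (rule reaches_bound[OF assms])

text \<open>After a first round of size \<open>x\<close> the target left is \<open>b - x\<close>. If
  it is positive, the empty sum misses it, so the condition \<open>1 \<le> r\<close> in
  \<open>reaches\<close> comes for free.\<close>

lemma hitting_Stream:
  assumes "stream_all (\<lambda>n. 1 \<le> n) \<omega>" and "1 \<le> x" "1 \<le> b"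
  shows "hitting b (x ## \<omega>) = (if b \<le> x then 1 else Suc (hitting (b - x) \<omega>))"
proof -
  have r: "reaches b (x ## \<omega>) (Suc r) \<longleftrightarrow> b \<le> x + (\<Sum>i<r. \<omega> !! i)" for r
    by (simp add: sum.lessThan_Suc_shift del: sum.lessThan_Suc)
  have "stream_all (\<lambda>n. 1 \<le> n) (x ## \<omega>)"
    using assms by (simp add: stream_all_Stream)
  then have "hitting b (x ## \<omega>) = Suc (LEAST r. reaches b (x ## \<omega>) (Suc r))"
    unfolding hitting_def by (intro Least_Suc[where P = "reaches b (x ## \<omega>)", OF reaches_bound]) (use assms in auto)
  also have "\<dots> = Suc (LEAST r. b \<le> x + (\<Sum>i<r. \<omega> !! i))"
    by (simp only: r)
  also have "\<dots> = (if b \<le> x then 1 else Suc (hitting (b - x) \<omega>))"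
  proof (cases "b \<le> x")
    case True
    then show ?thesis by (simp add: Least_eq_0)
  next
    case False
    then have "b \<le> x + (\<Sum>i<r. \<omega> !! i) \<longleftrightarrow> reaches (b - x) \<omega> r" for r
      by (cases r) auto
    then show ?thesis using False by (simp add: hitting_def)
  qed
  finally show ?thesis .
qed

lemma measurable_hitting [measurable]:
  "hitting b \<in> measurable (stream_space (measure_pmf p)) (count_space UNIV)"
proof -
  have [measurable]: "(\<lambda>\<omega>. \<omega> !! i) \<in> measurable (stream_space (measure_pmf p)) (count_space UNIV)" for i
    using measurable_snth[of i "measure_pmf p"] by (simp cong: measurable_cong_sets)
  show ?thesis unfolding hitting_def by measurable
qed

lemma gamma_rounds_hitting:
  "gamma_rounds \<alpha> a b = (\<integral>\<omega>. real (hitting b \<omega>) \<partial>stream_space (measure_pmf (round_pmf \<alpha> a)))"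
  by (simp add: gamma_rounds_def hitting_def)

lemma gamma_rounds_nonneg: "0 \<le> gamma_rounds \<alpha> a b"
  by (simp add: gamma_rounds_def)

text \<open>At \<open>b = 0\<close>, \<open>gamma_rounds\<close> is 1 (it counts at least one round), but the renewal equation needs 0.\<close>

definition mean_rounds :: "real \<Rightarrow> nat \<Rightarrow> nat \<Rightarrow> real" where
  "mean_rounds \<alpha> a b = (if b = 0 then 0 else gamma_rounds \<alpha> a b)"

text \<open>Conditioning on the first round: the later rounds are again an i.i.d. sequence. The
  computation uses nonnegative integrals, where the decomposition of the stream space asks only for
  measurability, and returns to the reals at the end.\<close>

lemma mean_rounds_renewal:
  assumes \<alpha>: "\<alpha> \<in> {0..1}" and b: "1 \<le> b"
  shows "mean_rounds \<alpha> a b = 1 + round_mean \<alpha> a (\<lambda>n. mean_rounds \<alpha> a (b - n))"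
proof -
  define p where "p = round_pmf \<alpha> a"
  define S where "S = stream_space (measure_pmf p)"
  interpret S: prob_space S
    unfolding S_def by (rule prob_space.prob_space_stream_space[OF measure_pmf.prob_space_axioms])
  have [measurable]: "hitting b \<in> measurable S (count_space UNIV)" for b
    unfolding S_def by measurable
  have all: "AE \<omega> in S. stream_all (\<lambda>n. 1 \<le> n) \<omega>"
    unfolding S_def
    by (intro prob_space.AE_stream_all[OF measure_pmf.prob_space_axioms]) (auto simp: AE_measure_pmf_iff p_def dest: round_pmf_pos)
  \<comment> \<open>For positive targets the hitting time is almost surely at most \<open>b\<close>,
    hence integrable.\<close>
  have nn: "(\<integral>\<^sup>+\<omega>. ennreal (real (hitting b \<omega>)) \<partial>S) = ennreal (mean_rounds \<alpha> a b)" if "1 \<le> b" for b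
  proof -
    have "AE \<omega> in S. norm (real (hitting b \<omega>)) \<le> real b"
      using all by eventually_elim (use that hitting_le in auto)
    then have "integrable S (\<lambda>\<omega>. real (hitting b \<omega>))"
      by (rule S.integrable_const_bound) measurable
    then have "(\<integral>\<^sup>+\<omega>. ennreal (real (hitting b \<omega>)) \<partial>S) = ennreal (\<integral>\<omega>. real (hitting b \<omega>) \<partial>S)"
      by (rule nn_integral_eq_integral) simp
    then show ?thesis
      using that by (simp add: mean_rounds_def gamma_rounds_hitting S_def p_def)
  qed
  have nonneg: "0 \<le> mean_rounds \<alpha> a b" for b
    by (simp add: mean_rounds_def gamma_rounds_nonneg)
  have step: "(\<integral>\<^sup>+\<omega>. ennreal (real (hitting b (x ## \<omega>))) \<partial>S) = ennreal (1 + mean_rounds \<alpha> a (b - x))"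
    if "1 \<le> x" for x
  proof -
    have "(\<integral>\<^sup>+\<omega>. ennreal (real (hitting b (x ## \<omega>))) \<partial>S) =
        (\<integral>\<^sup>+\<omega>. (if b \<le> x then 1 else 1 + ennreal (real (hitting (b - x) \<omega>))) \<partial>S)"
      by (intro nn_integral_cong_AE, use all in eventually_elim)
        (use that b in \<open>simp add: hitting_Stream\<close>)
    also have "\<dots> = ennreal (1 + mean_rounds \<alpha> a (b - x))"
    proof (cases "b \<le> x")
      case True
      then show ?thesis by (simp add: S.emeasure_space_1 mean_rounds_def)
    next
      case False
      then show ?thesis
        using nn[of "b - x"] nonneg by (simp add: nn_integral_add S.emeasure_space_1)
    qed
    finally show ?thesis .
  qed
  have "ennreal (mean_rounds \<alpha> a b) = (\<integral>\<^sup>+\<omega>. ennreal (real (hitting b \<omega>)) \<partial>S)"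
    using nn[OF b] by simp
  also have "\<dots> = (\<integral>\<^sup>+x. (\<integral>\<^sup>+\<omega>. ennreal (real (hitting b (x ## \<omega>))) \<partial>S) \<partial>measure_pmf p)"
    unfolding S_def by (rule prob_space.nn_integral_stream_space[OF measure_pmf.prob_space_axioms]) measurable
  also have "\<dots> = (\<integral>\<^sup>+x. ennreal (1 + mean_rounds \<alpha> a (b - x)) \<partial>measure_pmf p)"
    by (intro nn_integral_cong_AE) (auto simp: AE_measure_pmf_iff p_def dest: round_pmf_pos intro!: step)
  also have "\<dots> = ennreal (\<integral>x. 1 + mean_rounds \<alpha> a (b - x) \<partial>measure_pmf p)"
    using nonneg finite_set_round_pmf[of \<alpha> a]
    by (intro nn_integral_eq_integral integrable_measure_pmf_finite) (auto simp: p_def)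
  also have "(\<integral>x. 1 + mean_rounds \<alpha> a (b - x) \<partial>measure_pmf p) =
      1 + (\<integral>x. mean_rounds \<alpha> a (b - x) \<partial>measure_pmf p)"
    using finite_set_round_pmf[of \<alpha> a]
    by (subst Bochner_Integration.integral_add) (auto simp: p_def intro!: integrable_measure_pmf_finite)
  finally have "ennreal (mean_rounds \<alpha> a b) = ennreal (1 + (\<integral>x. mean_rounds \<alpha> a (b - x) \<partial>measure_pmf p))" .
  moreover have "0 \<le> (\<integral>x. mean_rounds \<alpha> a (b - x) \<partial>measure_pmf p)"
    using nonneg by simp
  ultimately have "mean_rounds \<alpha> a b = 1 + (\<integral>x. mean_rounds \<alpha> a (b - x) \<partial>measure_pmf p)"
    using nonneg by (subst (asm) ennreal_inj) auto
  then show ?thesis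
    by (simp add: p_def integral_round_pmf[OF \<alpha>])
qed

text \<open>The geometric sum absorbs the special reading at rate 1, and it can be evaluated by
  additions and multiplications.\<close>

lemma target_factor_eq:
  "target_factor \<alpha> t = 1 / (\<Sum>i\<le>t. \<alpha> ^ i)"
  by (simp add: target_factor_def sum_gp0)

section \<open>Time-bounded execution\<close>

text \<open>Total correctness with a step bound. An upper bound instead of the exact count lets
  branches of different cost share one specification.\<close>

definition exec :: "com \<Rightarrow> state \<Rightarrow> nat \<Rightarrow> (state \<Rightarrow> bool) \<Rightarrow> bool" where
  "exec P s B Q \<longleftrightarrow> (\<exists>n s'. runs P s n s' \<and> n \<le> B \<and> Q s')"

lemma execI: "runs P s n s' \<Longrightarrow> n \<le> B \<Longrightarrow> Q s' \<Longrightarrow> exec P s B Q"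
  unfolding exec_def by blast

lemma exec_weaken:
  assumes "exec P s B Q" and "B \<le> B'" and "\<And>s'. Q s' \<Longrightarrow> Q' s'"
  shows "exec P s B' Q'"
  using assms unfolding exec_def by (meson order_trans)

lemma exec_Seq:
  assumes "exec P s B Q" and "\<And>s'. Q s' \<Longrightarrow> exec P' s' B' R" and "B + B' \<le> D"
  shows "exec (Seq P P') s D R"
proof -
  obtain n s' where 1: "runs P s n s'" "n \<le> B" "Q s'"
    using assms(1) by (auto simp: exec_def)
  obtain n' s'' where 2: "runs P' s' n' s''" "n' \<le> B'" "R s''"
    using assms(2)[OF 1(3)] by (auto simp: exec_def)
  have "n + n' \<le> D" using 1 2 assms(3) by simp
  then show ?thesis using runs.Seq[OF 1(1) 2(1)] 2(3) unfolding exec_def by blast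
qed

lemma exec_Cond:
  assumes "bval b s \<Longrightarrow> exec P s B R" and "\<not> bval b s \<Longrightarrow> exec P' s B R"
    and "1 + bcost b + B \<le> D"
  shows "exec (Cond b P P') s D R"
proof (cases "bval b s")
  case True
  then obtain n s' where "runs P s n s'" "n \<le> B" "R s'"
    using assms(1) by (auto simp: exec_def)
  then show ?thesis
    using runs.CondTrue[OF True, of P n s' P'] assms(3) unfolding exec_def
    by (intro exI[of _ "1 + bcost b + n"] exI[of _ s']) simp
next
  case False
  then obtain n s' where "runs P' s n s'" "n \<le> B" "R s'"
    using assms(2) by (auto simp: exec_def)
  then show ?thesis
    using runs.CondFalse[OF False, of P' n s' P] assms(3) unfolding exec_def
    by (intro exI[of _ "1 + bcost b + n"] exI[of _ s']) simp
qed

text \<open>The number \<open>N\<close> of iterations is known beforehand, so the invariant is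
  indexed by the iteration and termination needs no separate measure. The guard is evaluated once
  more than the body, whence the extra summand in the bound.\<close>

lemma exec_Loop:
  assumes step: "\<And>i s. i < N \<Longrightarrow> I i s \<Longrightarrow> bval b s \<and> exec P s B (I (Suc i))"
    and stop: "\<And>s. I N s \<Longrightarrow> \<not> bval b s"
    and start: "I 0 s"
    and bound: "N * (1 + bcost b + B) + 1 + bcost b \<le> D"
  shows "exec (Loop b P) s D (I N)"
proof -
  have "exec (Loop b P) s ((N - i) * (1 + bcost b + B) + 1 + bcost b) (I N)" if "i \<le> N" "I i s" for i s
    using that
  proof (induction i arbitrary: s rule: inc_induct)
    case base
    then show ?case using runs.LoopFalse[OF stop[OF base]] unfolding exec_def
      by (intro exI[of _ "1 + bcost b"] exI[of _ s]) simp
  next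
    case (step i)
    then have b: "bval b s" and "exec P s B (I (Suc i))"
      using assms(1) by auto
    then obtain n s' where 1: "runs P s n s'" "n \<le> B" "I (Suc i) s'"
      unfolding exec_def by blast
    then obtain n' s'' where 2: "runs (Loop b P) s' n' s''"
      "n' \<le> (N - Suc i) * (1 + bcost b + B) + 1 + bcost b" "I N s''"
      using step.IH[OF 1(3)] unfolding exec_def by blast
    have "N - i = Suc (N - Suc i)" using step.hyps by simp
    then have "1 + bcost b + n + n' \<le> (N - i) * (1 + bcost b + B) + 1 + bcost b"
      using 1(2) 2(2) by simp
    then show ?case
      using runs.LoopTrue[OF b 1(1) 2(1)] 2(3) unfolding exec_def by blast
  qed
  from this[of 0 s] show ?thesis
    using start bound by (auto intro: exec_weaken)
qed

section \<open>Loop-free programs\<close>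

primrec loop_free :: "com \<Rightarrow> bool" where
  "loop_free Skip \<longleftrightarrow> True"
| "loop_free (NStore x a e) \<longleftrightarrow> True"
| "loop_free (RStore x a e) \<longleftrightarrow> True"
| "loop_free (Seq P Q) \<longleftrightarrow> loop_free P \<and> loop_free Q"
| "loop_free (Cond b P Q) \<longleftrightarrow> loop_free P \<and> loop_free Q"
| "loop_free (Loop b P) \<longleftrightarrow> False"

text \<open>On loops, the values of the next two functions are irrelevant.\<close>

primrec effect :: "com \<Rightarrow> state \<Rightarrow> state" where
  "effect Skip s = s"
| "effect (NStore x a e) s = nupd x (nval a s) (nval e s) s"
| "effect (RStore x a e) s = rupd x (nval a s) (rval e s) s"
| "effect (Seq P Q) s = effect Q (effect P s)"
| "effect (Cond b P Q) s = (if bval b s then effect P s else effect Q s)"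
| "effect (Loop b P) s = s"

primrec max_cost :: "com \<Rightarrow> nat" where
  "max_cost Skip = 1"
| "max_cost (NStore x a e) = 1 + ncost a + ncost e"
| "max_cost (RStore x a e) = 1 + ncost a + rcost e"
| "max_cost (Seq P Q) = max_cost P + max_cost Q"
| "max_cost (Cond b P Q) = 1 + bcost b + max_cost P + max_cost Q"
| "max_cost (Loop b P) = 0"

text \<open>Without loops the final state is a function of the initial one, so verification becomes
  simplification of \<open>effect\<close>. At a conditional, \<open>max_cost\<close> adds the costs
  of both branches, which affects only constants.\<close>

lemma exec_loop_free:
  assumes "loop_free P" and "Q (effect P s)" and "max_cost P \<le> B"
  shows "exec P s B Q"
proof -
  have "exec P s (max_cost P) (\<lambda>s'. s' = effect P s)"
    using assms(1)
  proof (induction P arbitrary: s)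
    case (Seq P P')
    show ?case
      by (rule exec_Seq[OF Seq.IH(1), where B' = "max_cost P'"]) (use Seq in auto)
  next
    case (Cond b P P')
    show ?case
      using Cond exec_weaken[OF Cond.IH(1)] exec_weaken[OF Cond.IH(2)]
      by (intro exec_Cond[where B = "max_cost P + max_cost P'"]) simp_all
  qed (auto intro!: execI intro: runs.Skip runs.NStore[simplified] runs.RStore[simplified])
  then show ?thesis by (rule exec_weaken) (use assms in auto)
qed

section \<open>Frame conditions\<close>

primrec nwrites :: "com \<Rightarrow> string set" where
  "nwrites Skip = {}"
| "nwrites (NStore x a e) = {x}"
| "nwrites (RStore x a e) = {}"
| "nwrites (Seq P Q) = nwrites P \<union> nwrites Q"
| "nwrites (Cond b P Q) = nwrites P \<union> nwrites Q"
| "nwrites (Loop b P) = nwrites P"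

primrec rwrites :: "com \<Rightarrow> string set" where
  "rwrites Skip = {}"
| "rwrites (NStore x a e) = {}"
| "rwrites (RStore x a e) = {x}"
| "rwrites (Seq P Q) = rwrites P \<union> rwrites Q"
| "rwrites (Cond b P Q) = rwrites P \<union> rwrites Q"
| "rwrites (Loop b P) = rwrites P"

text \<open>Specifications of subprograms mention only their result; the frame, at the granularity
  of whole arrays, carries the caller's invariant across them.\<close>

definition framed :: "com \<Rightarrow> state \<Rightarrow> state \<Rightarrow> bool" where
  "framed P s s' \<longleftrightarrow>
     (\<forall>x. x \<notin> nwrites P \<longrightarrow> fst s' x = fst s x) \<and> (\<forall>x. x \<notin> rwrites P \<longrightarrow> snd s' x = snd s x)"

lemma runs_framed: "runs P s n s' \<Longrightarrow> framed P s s'"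
  by (induction rule: runs.induct) (auto simp: framed_def nupd_def rupd_def)

lemma exec_framed: "exec P s B Q \<Longrightarrow> exec P s B (\<lambda>s'. Q s' \<and> framed P s s')"
  unfolding exec_def using runs_framed by blast

lemma framed_fst: "framed P s s' \<Longrightarrow> x \<notin> nwrites P \<Longrightarrow> fst s' x = fst s x"
  by (simp add: framed_def)

abbreviation NVar :: "string \<Rightarrow> nexp" where "NVar x \<equiv> NCell x (NConst 0)"
abbreviation RVar :: "string \<Rightarrow> rexp" where "RVar x \<equiv> RCell x (NConst 0)"
abbreviation NSet :: "string \<Rightarrow> nexp \<Rightarrow> com" where "NSet x e \<equiv> NStore x (NConst 0) e"
abbreviation RSet :: "string \<Rightarrow> rexp \<Rightarrow> com" where "RSet x e \<equiv> RStore x (NConst 0) e"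
abbreviation NIncr :: "string \<Rightarrow> com" where "NIncr x \<equiv> NSet x (NAdd (NVar x) (NConst 1))"
abbreviation ROne :: rexp where "ROne \<equiv> ROfNat (NConst 1)"

fun seqs :: "com list \<Rightarrow> com" where
  "seqs [] = Skip"
| "seqs [P] = P"
| "seqs (P # Q # Ps) = Seq P (seqs (Q # Ps))"

lemmas upd_simps = nupd_def rupd_def

section \<open>Dynamic programming over partial hierarchies\<close>

definition prefix_latency :: "(nat \<Rightarrow> real) \<Rightarrow> (nat \<Rightarrow> nat \<Rightarrow> real) \<Rightarrow> hierarchy \<Rightarrow> nat \<Rightarrow> real" where
  "prefix_latency c \<alpha> h i = (\<Sum>i'=0..i. c (fst h ! i') * (\<Prod>j=i'..i. hier_factor \<alpha> h j))"

lemma prefix_latency_0: "prefix_latency c \<alpha> h 0 = c (fst h ! 0) * hier_factor \<alpha> h 0"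
  by (simp add: prefix_latency_def)

lemma prefix_latency_Suc:
  "prefix_latency c \<alpha> h (Suc i) = (prefix_latency c \<alpha> h i + c (fst h ! Suc i)) * hier_factor \<alpha> h (Suc i)"
  by (simp add: prefix_latency_def sum_distrib_right distrib_right mult.assoc)

lemma latency_eq_prefix: "latency c \<alpha> (\<sigma>, \<tau>) = prefix_latency c \<alpha> (\<sigma>, \<tau>) (length \<tau>)"
  by (simp add: latency_def prefix_latency_def)

locale hsd =
  fixes K T :: nat and c :: "nat \<Rightarrow> real" and \<alpha> :: "nat \<Rightarrow> nat \<Rightarrow> real"
  assumes inst: "hsd_instance K T c \<alpha>"
begin

lemma K_pos: "1 \<le> K" and T_pos: "1 \<le> T"
  and c_pos: "i \<le> K \<Longrightarrow> 0 < c i"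
  and \<alpha>_range: "i \<le> K \<Longrightarrow> j \<le> K \<Longrightarrow> \<alpha> i j \<in> {0..1}"
  using inst unfolding hsd_instance_def by blast+

text \<open>
  The numbers below \<open>K * T\<close> encode the pairs of a model below the target and a parameter value,
  and \<open>K * T\<close> itself encodes the target model (with an irrelevant parameter 1).
\<close>

definition goal :: nat where "goal = K * T"
definition model :: "nat \<Rightarrow> nat" where "model n = n div T"
definition param :: "nat \<Rightarrow> nat" where "param n = n mod T + 1"

text \<open>\<open>param n\<close> is at least 1, so \<open>mean_rounds\<close> coincides here with
  \<open>gamma_rounds\<close>; it is the quantity that the renewal equation determines.\<close>

definition factor :: "nat \<Rightarrow> nat \<Rightarrow> real" where
  "factor p n = (if n < goal then mean_rounds (\<alpha> (model p) (model n)) (param p) (param n)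
                 else target_factor (\<alpha> (model p) (model n)) (param p))"

text \<open>
  The target alone is not a hierarchy, so its initial value is chosen larger than that of the
  hierarchy through node 0.
\<close>

definition initial :: "(nat \<Rightarrow> real) \<Rightarrow> nat \<Rightarrow> real" where
  "initial d n = (if n < goal then c (model n) * real (param n) else d 0 + c (model n) + 1)"

definition via :: "(nat \<Rightarrow> real) \<Rightarrow> nat \<Rightarrow> nat \<Rightarrow> real" where
  "via d n p = (d p + c (model n)) * factor p n"

text \<open>
  \<open>d\<close> holds the least latencies up to a node, \<open>q\<close> the predecessors and \<open>l\<close> the numbers of
  predecessors, where only nodes below \<open>j\<close> have been tried as direct predecessors of \<open>n\<close>.
\<close>

definition optimal :: "(nat \<Rightarrow> real) \<Rightarrow> (nat \<Rightarrow> nat) \<Rightarrow> (nat \<Rightarrow> nat) \<Rightarrow> nat \<Rightarrow> nat \<Rightarrow> bool" where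
  "optimal d q l n j \<longleftrightarrow>
     d n \<le> initial d n \<and> (\<forall>p<j. model p < model n \<longrightarrow> d n \<le> via d n p) \<and>
     (l n = 0 \<and> d n = initial d n \<or>
      q n < j \<and> model (q n) < model n \<and> l n = Suc (l (q n)) \<and> d n = via d n (q n))"

text \<open>All entries read have index at most \<open>n\<close>: node 0, the candidates below
  \<open>j\<close>, and \<open>n\<close> itself. Writes for later nodes therefore leave solved nodes
  intact.\<close>

lemma optimal_cong:
  assumes "\<And>p. p \<le> n \<Longrightarrow> d p = d' p" and "\<And>p. p \<le> n \<Longrightarrow> q p = q' p"
    and "\<And>p. p \<le> n \<Longrightarrow> l p = l' p" and "j \<le> n"
  shows "optimal d q l n j \<longleftrightarrow> optimal d' q' l' n j"
  using assms by (auto simp: optimal_def initial_def via_def)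

lemma model_goal: "model goal = K" and param_goal: "param goal = 1"
  using T_pos by (auto simp: model_def param_def goal_def)

lemma goal_pos: "0 < goal"
  using T_pos K_pos by (simp add: goal_def)

lemma param_range: "1 \<le> param n" "param n \<le> T"
  using T_pos mod_less_divisor[of T n] by (auto simp: param_def simp del: mod_less_divisor)

lemma model_less: "n < goal \<Longrightarrow> model n < K"
  by (simp add: model_def goal_def less_mult_imp_div_less)

lemma model_le: "n \<le> goal \<Longrightarrow> model n \<le> K"
  using model_less model_goal by (cases "n = goal") (auto intro: less_imp_le)

text \<open>The encoding sorts nodes by model first, so increasing node numbers are a topological
  order of the transitions.\<close>

lemma less_if_model_less: "model p < model n \<Longrightarrow> p < n"
  unfolding model_def by (metis div_le_mono not_less)

lemma factor_nonneg:
  assumes "p \<le> goal" "n \<le> goal"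
  shows "0 \<le> factor p n"
  using \<alpha>_range[OF model_le model_le, OF assms]
  by (auto simp: factor_def mean_rounds_def gamma_rounds_nonneg target_factor_eq
      intro!: divide_nonneg_nonneg sum_nonneg)

text \<open>The term of exponent 0 alone makes the denominator at least 1. This serves to show that
  the target never keeps its initial value.\<close>

lemma target_factor_le: "\<beta> \<in> {0..1} \<Longrightarrow> target_factor \<beta> t \<le> 1"
  using member_le_sum[of 0 "{..t}" "\<lambda>i. \<beta> ^ i"] by (simp add: target_factor_eq divide_le_eq_1)

end

section \<open>Reading off an optimal hierarchy from a solved table\<close>

locale hsd_optimum = hsd +
  fixes d :: "nat \<Rightarrow> real" and q l :: "nat \<Rightarrow> nat"
  assumes opt: "n \<le> goal \<Longrightarrow> optimal d q l n n"
begin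

lemma d_nonneg: "n \<le> goal \<Longrightarrow> 0 \<le> d n"
proof (induction n rule: less_induct)
  case (less n)
  have c: "0 < c (model n)" using c_pos[OF model_le[OF less.prems]] .
  show ?case
  proof (cases "d n = initial d n")
    case True
    show ?thesis
    proof (cases "n < goal")
      case False
      then have "0 \<le> d 0" using less goal_pos by auto
      then show ?thesis using True False c by (simp add: initial_def)
    qed (use True c in \<open>simp add: initial_def\<close>)
  next
    case False
    then have "q n < n" "d n = via d n (q n)"
      using opt[OF less.prems] by (auto simp: optimal_def)
    then show ?thesis
      using less.IH[of "q n"] less.prems factor_nonneg[of "q n" n] c by (simp add: via_def)
  qed
qed

text \<open>Entering the target from node 0 yields at most \<open>d 0 + c K\<close>, strictly less
  than the initial value of the target. So the target has a predecessor, as a hierarchy with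
  \<open>m \<ge> 1\<close> demands.\<close>

lemma length_goal_pos: "0 < l goal"
proof -
  have "model 0 < model goal"
    using K_pos by (simp add: model_goal) (simp add: model_def)
  then have "d goal \<le> via d goal 0"
    using opt[of goal] goal_pos by (simp add: optimal_def)
  also have "\<dots> \<le> (d 0 + c K) * 1"
    unfolding via_def factor_def model_goal
    using target_factor_le[of "\<alpha> (model 0) K" "param 0"] \<alpha>_range[of "model 0" K] model_le[of 0]
      d_nonneg[of 0] c_pos[of K]
    by (intro mult_mono) (auto intro: model_le simp: target_factor_eq intro!: sum_nonneg)
  also have "\<dots> < initial d goal" by (simp add: initial_def model_goal)
  finally show ?thesis using opt[of goal] by (auto simp: optimal_def)
qed

text \<open>Each predecessor link strictly lowers the model. This bounds the output phase by
  \<open>O(K)\<close>.\<close>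

lemma length_le: "n \<le> goal \<Longrightarrow> l n \<le> model n"
proof (induction n rule: less_induct)
  case (less n)
  show ?case
    using opt[OF less.prems] less.IH[of "q n"] less.prems by (fastforce simp: optimal_def)
qed

text \<open>Predecessor links run backwards from the target; the subtraction numbers the nodes from
  the front, as in a hierarchy.\<close>

definition chain :: "nat \<Rightarrow> nat" where
  "chain i = (q ^^ (l goal - i)) goal"

lemma chain_goal: "chain (l goal) = goal"
  by (simp add: chain_def)

lemma chain_pred: "i < l goal \<Longrightarrow> chain i = q (chain (Suc i))"
  by (simp add: chain_def flip: Suc_diff_Suc)

text \<open>Each link lowers \<open>l\<close> by one, and a positive \<open>l\<close> rules out the
  alternative of an initial value. So the links last exactly until index 0.\<close>

lemma chain_props: "i \<le> l goal \<Longrightarrow> chain i \<le> goal \<and> l (chain i) = i"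
proof (induction i rule: inc_induct)
  case base
  show ?case by (simp add: chain_goal)
next
  case (step i)
  then show ?case
    using opt[of "chain (Suc i)"] by (simp add: chain_pred optimal_def)
qed

lemma chain_step:
  assumes "i < l goal"
  shows "model (chain i) < model (chain (Suc i))"
    and "d (chain (Suc i)) = via d (chain (Suc i)) (chain i)"
  using opt[of "chain (Suc i)"] chain_props[of "Suc i"] assms
  by (auto simp: chain_pred optimal_def)

lemma chain_less_goal: "i < l goal \<Longrightarrow> chain i < goal"
  using less_if_model_less[OF chain_step(1)] chain_props[of "Suc i"] by fastforce

lemma chain_0: "d (chain 0) = initial d (chain 0)"
  using opt[of "chain 0"] chain_props[of 0] by (simp add: optimal_def)

definition chain_hierarchy :: hierarchy where
  "chain_hierarchy = (map (\<lambda>i. model (chain i)) [0..<l goal + 1], map (\<lambda>i. param (chain i)) [0..<l goal])"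

lemma chain_strict_mono: "i < j \<Longrightarrow> j \<le> l goal \<Longrightarrow> model (chain i) < model (chain j)"
proof (induction j)
  case (Suc j)
  then show ?case using chain_step(1)[of j] by (cases "i = j") auto
qed simp

lemma chain_hierarchy_in: "chain_hierarchy \<in> hierarchies K T"
  using length_goal_pos chain_props param_range
  by (auto simp: hierarchies_def chain_hierarchy_def sorted_wrt_iff_nth_less chain_strict_mono
      nth_append chain_goal model_goal model_le simp del: upt_Suc)

text \<open>The encoding \<open>e\<close> is kept general to serve both the chain of predecessors
  and an arbitrary competitor. Only the last node is \<open>goal\<close>, so the case split in
  \<open>factor\<close> matches that in \<open>hier_factor\<close>.\<close>

lemma hier_factor_eq:
  assumes "\<And>i. i \<le> length \<tau> \<Longrightarrow> model (e i) = \<sigma> ! i"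
    and "\<And>i. i < length \<tau> \<Longrightarrow> param (e i) = \<tau> ! i"
    and "\<And>i. i < length \<tau> \<Longrightarrow> e i < goal" and "e (length \<tau>) = goal" and "1 \<le> length \<tau>"
  shows "hier_factor \<alpha> (\<sigma>, \<tau>) 0 = real (param (e 0))"
    and "i < length \<tau> \<Longrightarrow> hier_factor \<alpha> (\<sigma>, \<tau>) (Suc i) = factor (e i) (e (Suc i))"
proof -
  show "hier_factor \<alpha> (\<sigma>, \<tau>) 0 = real (param (e 0))"
    using assms(2)[of 0] assms(5) by (cases \<tau>) (auto simp: hier_factor_def)
next
  assume i: "i < length \<tau>"
  show "hier_factor \<alpha> (\<sigma>, \<tau>) (Suc i) = factor (e i) (e (Suc i))"
  proof (cases "Suc i < length \<tau>")
    case True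
    then show ?thesis
      using i assms(1)[of i] assms(1)[of "Suc i"] assms(2)[of i] assms(2)[of "Suc i"]
        assms(3)[of "Suc i"] param_range(1)[of "e (Suc i)"]
      by (simp add: hier_factor_def factor_def mean_rounds_def)
  next
    case False
    then have "length \<tau> = Suc i" using i by simp
    then show ?thesis
      using i assms(1)[of i] assms(1)[of "Suc i"] assms(2)[of i] assms(4)
      by (simp add: hier_factor_def factor_def)
  qed
qed

text \<open>Along the chain, the equation \<open>d n = via d n (q n)\<close> is the recursion of
  \<open>prefix_latency\<close>, started at an initial value.\<close>

lemma latency_chain: "latency c \<alpha> chain_hierarchy = d goal"
proof -
  define \<sigma> \<tau> where "\<sigma> = fst chain_hierarchy" and "\<tau> = snd chain_hierarchy"
  have len: "length \<tau> = l goal" by (simp add: \<tau>_def chain_hierarchy_def)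
  have \<sigma>: "\<sigma> ! i = model (chain i)" if "i \<le> l goal" for i
    using that by (simp add: \<sigma>_def chain_hierarchy_def nth_append del: upt_Suc)
  have \<tau>: "\<tau> ! i = param (chain i)" if "i < l goal" for i
    using that by (simp add: \<tau>_def chain_hierarchy_def)
  have "1 \<le> length \<tau>" using length_goal_pos len by simp
  note f = hier_factor_eq[of \<tau> chain \<sigma>, unfolded len, OF \<sigma>[symmetric] \<tau>[symmetric] chain_less_goal
      chain_goal this[unfolded len]]
  have "prefix_latency c \<alpha> (\<sigma>, \<tau>) i = d (chain i)" if "i \<le> l goal" for i
    using that
  proof (induction i)
    case 0
    have "chain 0 < goal" using chain_less_goal length_goal_pos by simp
    then show ?case by (simp add: prefix_latency_0 f(1) \<sigma> chain_0 initial_def)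
  next
    case (Suc i)
    then show ?case by (simp add: prefix_latency_Suc f(2) \<sigma> chain_step(2) via_def)
  qed
  from this[of "l goal"] have "latency c \<alpha> (\<sigma>, \<tau>) = d goal"
    by (simp add: latency_eq_prefix len chain_goal)
  then show ?thesis by (simp add: \<sigma>_def \<tau>_def)
qed

text \<open>Bellman's argument: along the nodes of a competitor, the inequalities
  \<open>d n \<le> via d n p\<close> bound each prefix latency from below by induction, since
  nonnegative factors make \<open>via\<close> monotone in the preceding value.\<close>

lemma d_goal_le:
  assumes "h \<in> hierarchies K T"
  shows "d goal \<le> latency c \<alpha> h"
proof -
  obtain \<sigma> \<tau> where h: "h = (\<sigma>, \<tau>)" by (cases h)
  let ?m = "length \<tau>"
  have m: "1 \<le> ?m" and len: "length \<sigma> = ?m + 1" and sorted: "sorted_wrt (<) \<sigma>"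
    and last: "\<sigma> ! ?m = K" and \<tau>: "set \<tau> \<subseteq> {1..T}"
    using assms by (auto simp: h hierarchies_def)
  have less: "\<sigma> ! i < \<sigma> ! j" if "i < j" "j \<le> ?m" for i j
    using sorted_wrt_nth_less[OF sorted that(1)] that len by simp
  \<comment> \<open>The inverse of the pair \<open>model\<close>, \<open>param\<close>; parameters
    start at 1, hence the subtraction.\<close>
  define e where "e i = (if i < ?m then \<sigma> ! i * T + (\<tau> ! i - 1) else goal)" for i
  have \<tau>_nth: "1 \<le> \<tau> ! i" "\<tau> ! i \<le> T" if "i < ?m" for i
    using \<tau> nth_mem[OF that] by auto
  have m1: "model (e i) = \<sigma> ! i" if "i \<le> ?m" for i
  proof (cases "i = ?m")
    case True
    then show ?thesis using last model_goal by (simp add: e_def)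
  next
    case False
    moreover from False that obtain u where "\<tau> ! i = Suc u" "u < T"
      using \<tau>_nth[of i] by (cases "\<tau> ! i") auto
    ultimately show ?thesis using that by (simp add: e_def model_def)
  qed
  have p1: "param (e i) = \<tau> ! i" if "i < ?m" for i
  proof -
    from that obtain u where "\<tau> ! i = Suc u" "u < T"
      using \<tau>_nth[of i] by (cases "\<tau> ! i") auto
    then show ?thesis using that by (simp add: e_def param_def)
  qed
  have e_less: "e i < goal" if "i < ?m" for i
    using less[of i ?m] that m1[of i] last model_goal by (simp add: less_if_model_less)
  have e_goal: "e ?m = goal" by (simp add: e_def)
  have e_le: "e i \<le> goal" if "i \<le> ?m" for i
    using that e_less[of i] e_goal by (cases "i = ?m") auto
  note f = hier_factor_eq[of \<tau> e \<sigma>, OF m1 p1 e_less e_goal m]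
  have "d (e i) \<le> prefix_latency c \<alpha> (\<sigma>, \<tau>) i" if "i \<le> ?m" for i
    using that
  proof (induction i)
    case 0
    have "e 0 < goal" by (rule e_less) (use m in linarith)
    then show ?case
      using opt[of "e 0"] by (simp add: prefix_latency_0 f(1) m1[symmetric] optimal_def initial_def)
  next
    case (Suc i)
    have "model (e i) < model (e (Suc i))" using less[of i "Suc i"] Suc.prems m1 by simp
    moreover from this have "e i < e (Suc i)" by (rule less_if_model_less)
    ultimately have "d (e (Suc i)) \<le> via d (e (Suc i)) (e i)"
      using opt[OF e_le[OF Suc.prems]] by (simp add: optimal_def)
    also have "\<dots> \<le> (prefix_latency c \<alpha> (\<sigma>, \<tau>) i + c (model (e (Suc i)))) * factor (e i) (e (Suc i))"
      unfolding via_def using Suc factor_nonneg[of "e i" "e (Suc i)"] e_le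
      by (intro mult_right_mono) auto
    finally show ?case using Suc.prems by (simp add: prefix_latency_Suc f(2) m1)
  qed
  from this[of ?m] show ?thesis by (simp add: h latency_eq_prefix e_goal)
qed

lemma chain_hierarchy_minimal:
  "is_arg_min (latency c \<alpha>) (\<lambda>h. h \<in> hierarchies K T) chain_hierarchy"
  using chain_hierarchy_in d_goal_le by (auto simp: is_arg_min_linorder latency_chain)

end

section \<open>Programs for the two kinds of factors\<close>

text \<open>
  The recursion of \<open>round_mean\<close> is unrolled from the inside: after \<open>j\<close> iterations, \<open>w\<close> holds the mean
  over rounds with parameter \<open>j\<close>, started when \<open>a - j\<close> trials have succeeded.
\<close>

definition rounds_body :: com where
  "rounds_body = seqs
    [RSet ''w'' (RAdd (RMul (RSub ROne (RVar ''x'')) (RCell ''H'' (NSub (NVar ''y'') (NSub (NVar ''a'') (NVar ''j'')))))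
                      (RMul (RVar ''x'') (RVar ''w''))),
     NIncr ''j'']"

definition rounds_loop :: com where
  "rounds_loop = Loop (NLess (NVar ''j'') (NVar ''a'')) rounds_body"

definition rounds_init :: com where
  "rounds_init = seqs
    [RSet ''w'' (RCell ''H'' (NSub (NVar ''y'') (NAdd (NVar ''a'') (NConst 1)))), NSet ''j'' (NConst 0)]"

definition rounds_prog :: com where
  "rounds_prog = Seq rounds_init rounds_loop"

lemma exec_rounds_prog:
  defines "val s \<equiv> round_mean (snd s ''x'' 0) (fst s ''a'' 0) (\<lambda>n. snd s ''H'' (fst s ''y'' 0 - n))"
  shows "exec rounds_prog s (100 * fst s ''a'' 0 + 100) (\<lambda>s'. snd s' ''w'' 0 = val s)"
proof -
  define \<beta> a y H where vars: "\<beta> = snd s ''x'' 0" "a = fst s ''a'' 0" "y = fst s ''y'' 0" "H = snd s ''H''"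
  define I where "I i s' \<longleftrightarrow> fst s' ''j'' 0 = i \<and> fst s' ''a'' 0 = a \<and> fst s' ''y'' 0 = y \<and>
     snd s' ''x'' 0 = \<beta> \<and> snd s' ''H'' = H \<and>
     snd s' ''w'' 0 = round_mean \<beta> i (\<lambda>n. H (y - (a - i) - n))" for i and s' :: state
  have loop: "exec rounds_loop s' (100 * a + 50) (I a)" if "I 0 s'" for s'
    unfolding rounds_loop_def
  proof (rule exec_Loop[where I = I and B = 50, OF _ _ that])
    fix i s' assume i: "i < a" and I: "I i s'"
    \<comment> \<open>Allowing one more trial starts the mean one success earlier, which cancels the
      shift of the argument in \<open>round_mean\<close>.\<close>
    have "y - (a - Suc i) - Suc n = y - (a - i) - n" for n
      using i by simp
    then have "round_mean \<beta> (Suc i) (\<lambda>n. H (y - (a - Suc i) - n)) =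
        (1 - \<beta>) * H (y - (a - i)) + \<beta> * round_mean \<beta> i (\<lambda>n. H (y - (a - i) - n))"
      by (simp add: Suc_diff_Suc i)
    then have "I (Suc i) (effect rounds_body s')"
      using I unfolding I_def by (simp add: rounds_body_def upd_simps)
    then show "bval (NLess (NVar ''j'') (NVar ''a'')) s' \<and> exec rounds_body s' 50 (I (Suc i))"
      using i I by (auto simp: I_def rounds_body_def intro!: exec_loop_free)
  qed (auto simp: I_def)
  have init: "exec rounds_init s 50 (I 0)"
    by (rule exec_loop_free) (simp_all add: rounds_init_def I_def vars upd_simps)
  have "exec rounds_prog s (100 * a + 100) (I a)"
    unfolding rounds_prog_def by (rule exec_Seq[OF init loop]) simp_all
  then show ?thesis
    by (rule exec_weaken) (auto simp: I_def vars val_def)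
qed

definition gamma_body :: com where
  "gamma_body = Seq rounds_prog (Seq (RStore ''H'' (NVar ''y'') (RAdd ROne (RVar ''w''))) (NIncr ''y''))"

definition gamma_loop :: com where
  "gamma_loop = Loop (NLess (NVar ''y'') (NAdd (NVar ''b'') (NConst 1))) gamma_body"

text \<open>The stored 0 is the value of \<open>mean_rounds\<close> at target 0; truncated
  subtraction sends every overshoot of the target to this cell.\<close>

definition gamma_init :: com where
  "gamma_init = Seq (RStore ''H'' (NConst 0) (ROfNat (NConst 0))) (NSet ''y'' (NConst 1))"

definition gamma_prog :: com where
  "gamma_prog = Seq gamma_init (Seq gamma_loop (RSet ''F'' (RCell ''H'' (NVar ''b''))))"

text \<open>Since a round contributes at least 1, the renewal equation refers only to smaller
  targets, so the table \<open>H\<close> is filled in increasing order. Each of the \<open>b\<close>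
  new entries costs \<open>O(a)\<close> steps, up to constants for \<open>a = 0\<close>.\<close>

lemma exec_gamma_prog:
  assumes "snd s ''x'' 0 \<in> {0..1}" and "fst s ''a'' 0 \<le> T" and "fst s ''b'' 0 \<le> T" and "1 \<le> T"
  shows "exec gamma_prog s (500 * T ^ 2)
    (\<lambda>s'. snd s' ''F'' 0 = mean_rounds (snd s ''x'' 0) (fst s ''a'' 0) (fst s ''b'' 0))"
proof -
  define \<beta> a b where vars: "\<beta> = snd s ''x'' 0" "a = fst s ''a'' 0" "b = fst s ''b'' 0"
  have \<beta>: "\<beta> \<in> {0..1}" and T: "a \<le> T" "b \<le> T" "1 \<le> T" using assms by (auto simp: vars)
  define I where "I i s' \<longleftrightarrow> fst s' ''y'' 0 = i + 1 \<and> fst s' ''a'' 0 = a \<and> fst s' ''b'' 0 = b \<and>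
     snd s' ''x'' 0 = \<beta> \<and> (\<forall>v\<le>i. snd s' ''H'' v = mean_rounds \<beta> a v)" for i and s' :: state
  have loop: "exec gamma_loop s' (b * (100 * a + 150) + 50) (I b)" if "I 0 s'" for s'
    unfolding gamma_loop_def
  proof (rule exec_Loop[where I = I and B = "100 * a + 120", OF _ _ that])
    fix i s' assume i: "i < b" and I: "I i s'"
    have "exec rounds_prog s' (100 * a + 100) (\<lambda>s''. snd s'' ''w'' 0 =
       round_mean \<beta> a (\<lambda>n. snd s' ''H'' (fst s' ''y'' 0 - n)))"
      using I exec_rounds_prog[of s'] by (simp add: I_def)
    then have "exec gamma_body s' (100 * a + 120) (I (Suc i))"
      unfolding gamma_body_def
    proof (rule exec_Seq[OF exec_framed, where B' = 20])
      fix s''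
      assume s'': "snd s'' ''w'' 0 = round_mean \<beta> a (\<lambda>n. snd s' ''H'' (fst s' ''y'' 0 - n)) \<and>
        framed rounds_prog s' s''"
      \<comment> \<open>Only arguments \<open>n \<ge> 1\<close> matter, so the cell at index
        \<open>Suc i\<close>, still to be filled, is never read.\<close>
      have "round_mean \<beta> a (\<lambda>n. snd s' ''H'' (fst s' ''y'' 0 - n)) =
          round_mean \<beta> a (\<lambda>n. mean_rounds \<beta> a (Suc i - n))"
        using I by (intro round_mean_cong) (simp add: I_def)
      then have "snd s'' ''w'' 0 + 1 = mean_rounds \<beta> a (Suc i)"
        using mean_rounds_renewal[OF \<beta>, of "Suc i" a] s'' by simp
      then show "exec (Seq (RStore ''H'' (NVar ''y'') (RAdd ROne (RVar ''w''))) (NIncr ''y'')) s'' 20 (I (Suc i))"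
        using I s''
        by (intro exec_loop_free)
          (auto simp: I_def upd_simps framed_def rounds_prog_def rounds_init_def rounds_loop_def rounds_body_def le_Suc_eq)
    qed simp
    then show "bval (NLess (NVar ''y'') (NAdd (NVar ''b'') (NConst 1))) s' \<and>
        exec gamma_body s' (100 * a + 120) (I (Suc i))"
      using i I by (auto simp: I_def)
  qed (auto simp: I_def algebra_simps)
  have finish: "exec (Seq gamma_loop (RSet ''F'' (RCell ''H'' (NVar ''b'')))) s' (b * (100 * a + 150) + 100)
     (\<lambda>s'. snd s' ''F'' 0 = mean_rounds \<beta> a b)" if "I 0 s'" for s'
    by (rule exec_Seq[OF loop[OF that], where B' = 50]) (auto simp: I_def upd_simps intro!: exec_loop_free)
  have init: "exec gamma_init s 50 (I 0)"
    by (rule exec_loop_free) (auto simp: gamma_init_def I_def vars upd_simps mean_rounds_def)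
  have "exec gamma_prog s (b * (100 * a + 150) + 150) (\<lambda>s'. snd s' ''F'' 0 = mean_rounds \<beta> a b)"
    unfolding gamma_prog_def by (rule exec_Seq[OF init finish]) simp_all
  moreover have "b * (100 * a + 150) + 150 \<le> 500 * T ^ 2"
  proof -
    have "b * (100 * a + 150) + 150 \<le> T * (100 * T + 150) + T * 150"
      using T by (intro add_mono mult_mono) auto
    also have "\<dots> = T * (100 * T + 300)" by (simp add: distrib_left)
    also have "\<dots> \<le> T * (500 * T)" using T by (intro mult_left_mono) auto
    finally show ?thesis by (simp add: power2_eq_square mult.left_commute)
  qed
  ultimately show ?thesis
    by (rule exec_weaken) (simp add: vars)
qed

definition target_body :: com where
  "target_body = Seq (RSet ''w'' (RAdd ROne (RMul (RVar ''x'') (RVar ''w'')))) (NIncr ''j'')"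

definition target_loop :: com where
  "target_loop = Loop (NLess (NVar ''j'') (NVar ''a'')) target_body"

definition target_init :: com where
  "target_init = Seq (RSet ''w'' ROne) (NSet ''j'' (NConst 0))"

definition target_prog :: com where
  "target_prog = Seq target_init (Seq target_loop (RSet ''F'' (RDiv ROne (RVar ''w''))))"

text \<open>Horner's rule for the geometric sum in \<open>target_factor_eq\<close>.\<close>

lemma exec_target_prog:
  "exec target_prog s (50 * fst s ''a'' 0 + 100)
    (\<lambda>s'. snd s' ''F'' 0 = target_factor (snd s ''x'' 0) (fst s ''a'' 0))"
proof -
  define \<beta> a where vars: "\<beta> = snd s ''x'' 0" "a = fst s ''a'' 0"
  define I where "I i s' \<longleftrightarrow> fst s' ''j'' 0 = i \<and> fst s' ''a'' 0 = a \<and>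
     snd s' ''x'' 0 = \<beta> \<and> snd s' ''w'' 0 = (\<Sum>v\<le>i. \<beta> ^ v)" for i and s' :: state
  have loop: "exec target_loop s' (50 * a + 30) (I a)" if "I 0 s'" for s'
    unfolding target_loop_def
  proof (rule exec_Loop[where I = I and B = 20, OF _ _ that])
    fix i s' assume i: "i < a" and I: "I i s'"
    have "(\<Sum>v\<le>Suc i. \<beta> ^ v) = 1 + \<beta> * (\<Sum>v\<le>i. \<beta> ^ v)"
      by (simp add: sum.atMost_Suc_shift sum_distrib_left del: sum.atMost_Suc)
    then have "I (Suc i) (effect target_body s')"
      using I unfolding I_def by (simp add: target_body_def upd_simps)
    then show "bval (NLess (NVar ''j'') (NVar ''a'')) s' \<and> exec target_body s' 20 (I (Suc i))"
      using i I by (auto simp: I_def target_body_def intro!: exec_loop_free)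
  qed (auto simp: I_def)
  have finish: "exec (Seq target_loop (RSet ''F'' (RDiv ROne (RVar ''w'')))) s' (50 * a + 50)
     (\<lambda>s'. snd s' ''F'' 0 = target_factor \<beta> a)" if "I 0 s'" for s'
    by (rule exec_Seq[OF loop[OF that], where B' = 20]) (auto simp: I_def upd_simps target_factor_eq intro!: exec_loop_free)
  have init: "exec target_init s 50 (I 0)"
    by (rule exec_loop_free) (simp_all add: target_init_def I_def vars upd_simps)
  have "exec target_prog s (50 * a + 100) (\<lambda>s'. snd s' ''F'' 0 = target_factor \<beta> a)"
    unfolding target_prog_def by (rule exec_Seq[OF init finish]) simp_all
  then show ?thesis by (simp add: vars)
qed

section \<open>The complete program\<close>

definition factor_prog :: com where
  "factor_prog = Cond (NLess (NVar ''n'') (NVar ''N'')) gamma_prog target_prog"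

lemma writes_factor_prog:
  "nwrites factor_prog = {''j'', ''y''}" "rwrites factor_prog = {''w'', ''H'', ''F''}"
  by (auto simp: factor_prog_def gamma_prog_def gamma_init_def gamma_loop_def gamma_body_def
      rounds_prog_def rounds_init_def rounds_loop_def rounds_body_def
      target_prog_def target_init_def target_loop_def target_body_def)

lemma exec_factor_prog:
  assumes "snd s ''x'' 0 \<in> {0..1}" "fst s ''a'' 0 \<le> T" "fst s ''b'' 0 \<le> T" "1 \<le> T"
  shows "exec factor_prog s (600 * T ^ 2) (\<lambda>s'. snd s' ''F'' 0 =
     (if fst s ''n'' 0 < fst s ''N'' 0 then mean_rounds (snd s ''x'' 0) (fst s ''a'' 0) (fst s ''b'' 0)
      else target_factor (snd s ''x'' 0) (fst s ''a'' 0)))"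
proof -
  have T: "T \<le> T ^ 2" "1 \<le> T ^ 2" using assms(4) by (auto simp: power2_eq_square)
  have "50 * fst s ''a'' 0 + 100 \<le> 500 * T ^ 2"
    using T assms(2) by linarith
  then show ?thesis
    unfolding factor_prog_def
    using exec_weaken[OF exec_gamma_prog[OF assms] order_refl] exec_weaken[OF exec_target_prog] T(2)
    by (intro exec_Cond[where B = "500 * T ^ 2"]) auto
qed

text \<open>Addresses cannot be multiplied. The offset of each model's row in \<open>alpha\<close>
  is therefore tabulated per node in \<open>na\<close>, and the column is added.\<close>

definition relax_init :: com where
  "relax_init = seqs
    [RSet ''x'' (RCell ''alpha'' (NAdd (NCell ''na'' (NVar ''p'')) (NVar ''k''))),
     NSet ''a'' (NCell ''nt'' (NVar ''p'')),
     NSet ''b'' (NVar ''t'')]"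

definition relax_update :: com where
  "relax_update = seqs
    [RSet ''e'' (RMul (RAdd (RCell ''D'' (NVar ''p'')) (RCell ''c'' (NVar ''k''))) (RVar ''F'')),
     Cond (RLess (RVar ''e'') (RCell ''D'' (NVar ''n'')))
       (seqs [RStore ''D'' (NVar ''n'') (RVar ''e''),
              NStore ''pi'' (NVar ''n'') (NVar ''p''),
              NStore ''len'' (NVar ''n'') (NAdd (NCell ''len'' (NVar ''p'')) (NConst 1))])
       Skip,
     NIncr ''p'']"

definition relax_prog :: com where
  "relax_prog = Cond (NLess (NCell ''nk'' (NVar ''p'')) (NVar ''k''))
     (Seq relax_init (Seq factor_prog relax_update)) (NIncr ''p'')"

definition relax_loop :: com where
  "relax_loop = Loop (NLess (NVar ''p'') (NVar ''n'')) relax_prog"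

definition node_init :: com where
  "node_init = seqs
    [NStore ''nk'' (NVar ''n'') (NVar ''k''), NStore ''nt'' (NVar ''n'') (NVar ''t''),
     NStore ''na'' (NVar ''n'') (NVar ''row''), NStore ''len'' (NVar ''n'') (NConst 0),
     NSet ''p'' (NConst 0),
     Cond (NLess (NVar ''n'') (NVar ''N''))
       (RStore ''D'' (NVar ''n'') (RMul (RCell ''c'' (NVar ''k'')) (ROfNat (NVar ''t''))))
       (RStore ''D'' (NVar ''n'') (RAdd (RAdd (RCell ''D'' (NConst 0)) (RCell ''c'' (NVar ''k''))) ROne))]"

text \<open>An odometer replaces the division and remainder behind \<open>model\<close> and
  \<open>param\<close>, and updates the row offset by addition.\<close>

definition node_next :: com where
  "node_next = Seq (NIncr ''n'')
     (Cond (NLess (NVar ''t'') (NVar ''Tmax'')) (NIncr ''t'')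
       (seqs [NSet ''t'' (NConst 1), NIncr ''k'',
              NSet ''row'' (NAdd (NVar ''row'') (NAdd (NVar ''K'') (NConst 1)))]))"

definition node_prog :: com where
  "node_prog = Seq node_init (Seq relax_loop node_next)"

definition node_loop :: com where
  "node_loop = Loop (NLess (NVar ''n'') (NAdd (NVar ''N'') (NConst 1))) node_prog"

text \<open>Repeated addition stands in for the product \<open>K * T\<close>.\<close>

definition goal_body :: com where
  "goal_body = Seq (NSet ''N'' (NAdd (NVar ''N'') (NVar ''Tmax''))) (NIncr ''i'')"

definition goal_loop :: com where
  "goal_loop = Loop (NLess (NVar ''i'') (NVar ''K'')) goal_body"

definition output_init :: com where
  "output_init = seqs
    [NSet ''m'' (NCell ''len'' (NVar ''N'')), RSet ''L'' (RCell ''D'' (NVar ''N'')),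
     NSet ''i'' (NAdd (NVar ''m'') (NConst 1)), NSet ''q'' (NVar ''N'')]"

text \<open>Links lead backwards, so the arrays are filled from index \<open>m\<close> down. The
  entry of \<open>tau\<close> at index \<open>m\<close> belongs to the target and is not read by
  \<open>out_hierarchy\<close>.\<close>

definition output_body :: com where
  "output_body = seqs
    [NSet ''i'' (NSub (NVar ''i'') (NConst 1)),
     NStore ''sigma'' (NVar ''i'') (NCell ''nk'' (NVar ''q'')),
     NStore ''tau'' (NVar ''i'') (NCell ''nt'' (NVar ''q'')),
     NSet ''q'' (NCell ''pi'' (NVar ''q''))]"

definition output_loop :: com where
  "output_loop = Loop (NLess (NConst 0) (NVar ''i'')) output_body"

definition hsd_prog :: com where
  "hsd_prog = Seq (Seq goal_loop (NSet ''t'' (NConst 1))) (Seq node_loop (Seq output_init output_loop))"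

section \<open>Invariants and running time of the complete program\<close>

context hsd
begin

definition input_ok :: "state \<Rightarrow> bool" where
  "input_ok s \<longleftrightarrow> fst s ''K'' 0 = K \<and> fst s ''Tmax'' 0 = T \<and> (\<forall>i\<le>K. snd s ''c'' i = c i) \<and>
     (\<forall>i\<le>K. \<forall>j\<le>K. snd s ''alpha'' (i * (K + 1) + j) = \<alpha> i j)"

definition tables :: "nat \<Rightarrow> state \<Rightarrow> bool" where
  "tables n s \<longleftrightarrow> (\<forall>p<n. fst s ''nk'' p = model p \<and> fst s ''nt'' p = param p \<and>
     fst s ''na'' p = model p * (K + 1))"

definition optimal_at :: "state \<Rightarrow> nat \<Rightarrow> nat \<Rightarrow> bool" where
  "optimal_at s n j \<longleftrightarrow> optimal (snd s ''D'') (fst s ''pi'') (fst s ''len'') n j"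

definition at_node :: "nat \<Rightarrow> state \<Rightarrow> bool" where
  "at_node n s \<longleftrightarrow> input_ok s \<and> fst s ''N'' 0 = goal \<and> fst s ''n'' 0 = n \<and>
     fst s ''k'' 0 = model n \<and> fst s ''t'' 0 = param n \<and> fst s ''row'' 0 = model n * (K + 1) \<and>
     (\<forall>p<n. optimal_at s p p)"

lemma at_node_framed:
  assumes "framed factor_prog s s'"
  shows "at_node n s' \<longleftrightarrow> at_node n s" "tables n s' \<longleftrightarrow> tables n s" "optimal_at s' n j \<longleftrightarrow> optimal_at s n j"
  using assms
  by (simp_all add: at_node_def input_ok_def tables_def optimal_at_def framed_def writes_factor_prog)

lemma optimal_start: "l n = 0 \<Longrightarrow> d n = initial d n \<Longrightarrow> optimal d q l n 0"
  by (simp add: optimal_def)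

text \<open>A smaller \<open>d n\<close> preserves all earlier upper bounds, and
  \<open>initial d n\<close> and the values \<open>via d n p\<close> read \<open>d\<close> only at
  other indices: \<open>j < n\<close> forces \<open>n\<close> to be nonzero.\<close>

lemma optimal_relax:
  assumes "optimal d q l n j" and "j < n" and "model j < model n"
  shows "via d n j < d n \<Longrightarrow> optimal (d(n := via d n j)) (q(n := j)) (l(n := Suc (l j))) n (Suc j)"
    and "\<not> via d n j < d n \<Longrightarrow> optimal d q l n (Suc j)"
  using assms by (auto simp: optimal_def initial_def via_def less_Suc_eq)

lemma optimal_skip:
  assumes "optimal d q l n j" and "\<not> model j < model n"
  shows "optimal d q l n (Suc j)"
  using assms by (auto simp: optimal_def less_Suc_eq)

lemma optimal_upd:
  assumes "p < n"
  shows "optimal (d(n := v)) q l p p \<longleftrightarrow> optimal d q l p p"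
    and "optimal d (q(n := u)) l p p \<longleftrightarrow> optimal d q l p p"
    and "optimal d q (l(n := u)) p p \<longleftrightarrow> optimal d q l p p"
  by (rule optimal_cong; use assms in simp)+

definition relaxed :: "nat \<Rightarrow> nat \<Rightarrow> state \<Rightarrow> bool" where
  "relaxed n j s \<longleftrightarrow> at_node n s \<and> tables (Suc n) s \<and> optimal_at s n j \<and> fst s ''p'' 0 = j"

lemma exec_relax_prog:
  assumes j: "j < n" and n: "n \<le> goal" and s: "relaxed n j s"
  shows "exec relax_prog s (800 * T ^ 2) (relaxed n (Suc j))"
  unfolding relax_prog_def
proof (rule exec_Cond[where B = "700 * T ^ 2"])
  have T: "1 \<le> T ^ 2" using T_pos by simp
  show "1 + bcost (NLess (NCell ''nk'' (NVar ''p'')) (NVar ''k'')) + 700 * T ^ 2 \<le> 800 * T ^ 2"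
    using T by simp
  have b: "bval (NLess (NCell ''nk'' (NVar ''p'')) (NVar ''k'')) s \<longleftrightarrow> model j < model n"
    using j s by (simp add: relaxed_def at_node_def tables_def)
  {
    assume "\<not> bval (NLess (NCell ''nk'' (NVar ''p'')) (NVar ''k'')) s"
    then show "exec (NIncr ''p'') s (700 * T ^ 2) (relaxed n (Suc j))"
      using s T b
      by (intro exec_loop_free)
        (simp_all add: relaxed_def at_node_def tables_def input_ok_def optimal_at_def upd_simps
          optimal_skip)
  next
    assume "bval (NLess (NCell ''nk'' (NVar ''p'')) (NVar ''k'')) s"
    then have m: "model j < model n" using b by simp
    define s1 where "s1 = effect relax_init s"
    have le: "model j \<le> K" "model n \<le> K" using j n model_le by auto
    have s1: "relaxed n j s1" "snd s1 ''x'' 0 = \<alpha> (model j) (model n)"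
      "fst s1 ''a'' 0 = param j" "fst s1 ''b'' 0 = param n"
      using s j le unfolding s1_def
      by (simp_all add: relax_init_def relaxed_def at_node_def tables_def input_ok_def optimal_at_def upd_simps)
    have "exec factor_prog s1 (600 * T ^ 2) (\<lambda>s'. snd s' ''F'' 0 = factor j n)"
      by (rule exec_weaken[OF exec_factor_prog[of s1 T]])
        (use s1 \<alpha>_range[OF le] param_range T_pos in
          \<open>simp_all add: factor_def relaxed_def at_node_def\<close>)
    then have "exec (Seq factor_prog relax_update) s1 (600 * T ^ 2 + 60) (relaxed n (Suc j))"
    proof (rule exec_Seq[OF exec_framed, where B' = 60])
      fix s2 assume s2: "snd s2 ''F'' 0 = factor j n \<and> framed factor_prog s1 s2"
      then have r: "relaxed n j s2"
        using s1(1) at_node_framed[of s1 s2] framed_fst[of factor_prog s1 s2 "''p''"]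
        by (simp add: relaxed_def writes_factor_prog)
      let ?d = "snd s2 ''D''"
      have e: "(?d j + snd s2 ''c'' (model n)) * snd s2 ''F'' 0 = via ?d n j"
        using r s2 le by (simp add: via_def relaxed_def at_node_def input_ok_def)
      show "exec relax_update s2 60 (relaxed n (Suc j))"
      proof (rule exec_loop_free)
        show "relaxed n (Suc j) (effect relax_update s2)"
          using r j m e optimal_relax[of ?d "fst s2 ''pi''" "fst s2 ''len''" n j]
          by (simp add: relax_update_def relaxed_def at_node_def tables_def input_ok_def
              optimal_at_def optimal_upd upd_simps)
      qed (simp_all add: relax_update_def)
    qed simp
    moreover have "exec relax_init s 40 (\<lambda>s'. s' = s1)"
      by (rule exec_loop_free) (simp_all add: s1_def relax_init_def)
    ultimately show "exec (Seq relax_init (Seq factor_prog relax_update)) s (700 * T ^ 2) (relaxed n (Suc j))"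
      using T by (auto intro: exec_Seq)
  }
qed

definition ready :: "nat \<Rightarrow> state \<Rightarrow> bool" where
  "ready n s \<longleftrightarrow> at_node n s \<and> tables n s"

lemma exec_node_prog:
  assumes n: "n \<le> goal" and s: "ready n s"
  shows "exec node_prog s (goal * (900 * T ^ 2) + 300) (ready (Suc n))"
proof -
  have T: "1 \<le> T ^ 2" using T_pos by simp
  have le: "model n \<le> K" using n by (rule model_le)
  have init: "exec node_init s 100 (relaxed n 0)"
  proof (rule exec_loop_free)
    \<comment> \<open>As \<open>goal\<close> is positive, the cell of \<open>D\<close> at index 0,
      read for the initial value of the target, is not the one being written.\<close>
    show "relaxed n 0 (effect node_init s)"
      using s le n goal_pos
      by (simp add: node_init_def relaxed_def ready_def at_node_def tables_def input_ok_def
          optimal_at_def optimal_upd upd_simps less_Suc_eq optimal_start initial_def model_goal)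
  qed (simp_all add: node_init_def)
  have loop: "exec relax_loop s' (goal * (900 * T ^ 2) + 100) (relaxed n n)" if "relaxed n 0 s'" for s'
    unfolding relax_loop_def
  proof (rule exec_Loop[where I = "relaxed n" and B = "800 * T ^ 2", OF _ _ that])
    fix j s' assume "j < n" "relaxed n j s'"
    then show "bval (NLess (NVar ''p'') (NVar ''n'')) s' \<and> exec relax_prog s' (800 * T ^ 2) (relaxed n (Suc j))"
      using exec_relax_prog[of j n s'] n by (simp add: relaxed_def at_node_def)
  next
    have "n * (1 + bcost (NLess (NVar ''p'') (NVar ''n'')) + 800 * T ^ 2) \<le> goal * (900 * T ^ 2)"
      using n T by (intro mult_mono) auto
    then show "n * (1 + bcost (NLess (NVar ''p'') (NVar ''n'')) + 800 * T ^ 2) + 1 +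
      bcost (NLess (NVar ''p'') (NVar ''n'')) \<le> goal * (900 * T ^ 2) + 100"
      by simp
  qed (simp add: relaxed_def at_node_def)
  have advance: "exec node_next s' 100 (ready (Suc n))" if "relaxed n n s'" for s'
  proof (rule exec_loop_free)
    have "model (Suc n) = (if param n < T then model n else Suc (model n))"
      "param (Suc n) = (if param n < T then Suc (param n) else 1)"
      using param_range[of n] by (auto simp: model_def param_def div_Suc mod_Suc)
    then show "ready (Suc n) (effect node_next s')"
      using that
      by (simp add: node_next_def relaxed_def ready_def at_node_def tables_def input_ok_def
          optimal_at_def upd_simps less_Suc_eq)
  qed (simp_all add: node_next_def)
  have "exec (Seq relax_loop node_next) s' (goal * (900 * T ^ 2) + 200) (ready (Suc n))"
    if "relaxed n 0 s'" for s'
    by (rule exec_Seq[OF loop[OF that] advance]) simp_all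
  then show ?thesis
    unfolding node_prog_def by (rule exec_Seq[OF init]) simp_all
qed

lemma exec_node_loop:
  assumes "ready 0 s"
  shows "exec node_loop s ((goal + 1) * (goal * (900 * T ^ 2) + 400)) (ready (Suc goal))"
proof -
  have "exec node_loop s (Suc goal * (goal * (900 * T ^ 2) + 310) + 90) (ready (Suc goal))"
    unfolding node_loop_def
  proof (rule exec_Loop[where I = ready and B = "goal * (900 * T ^ 2) + 300", OF _ _ assms])
    fix n s' assume "n < Suc goal" "ready n s'"
    then show "bval (NLess (NVar ''n'') (NAdd (NVar ''N'') (NConst 1))) s' \<and>
        exec node_prog s' (goal * (900 * T ^ 2) + 300) (ready (Suc n))"
      using exec_node_prog[of n s'] by (simp add: ready_def at_node_def)
  qed (auto simp: ready_def at_node_def algebra_simps)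
  then show ?thesis by (rule exec_weaken) (simp_all add: algebra_simps)
qed

lemma input_ok_hsd_input: "input_ok (hsd_input K T c \<alpha>)"
proof -
  have "i * (K + 1) + j < (K + 1) * (K + 1)" if "i \<le> K" "j \<le> K" for i j
  proof -
    have "i * (K + 1) \<le> K * (K + 1)" using that by (intro mult_right_mono) auto
    then show ?thesis using that by simp
  qed
  moreover have "(i * (K + 1) + j) div (K + 1) = i" "(i * (K + 1) + j) mod (K + 1) = j" if "j \<le> K" for i j
    using that by (simp_all add: div_mult_self3 del: mult_Suc_right add_Suc_right)
  ultimately show ?thesis
    unfolding input_ok_def hsd_input_def by simp
qed

text \<open>All auxiliary cells start at 0, so \<open>n\<close>, \<open>k\<close> and
  \<open>row\<close> already describe node 0; only \<open>t\<close> must be set, because parameters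
  start at 1.\<close>

lemma exec_goal_loop:
  "exec (Seq goal_loop (NSet ''t'' (NConst 1))) (hsd_input K T c \<alpha>) (K * 30 + 20) (ready 0)"
proof -
  define I where "I i s \<longleftrightarrow> input_ok s \<and> fst s ''N'' 0 = i * T \<and> fst s ''i'' 0 = i \<and>
    fst s ''n'' 0 = 0 \<and> fst s ''k'' 0 = 0 \<and> fst s ''row'' 0 = 0" for i and s :: state
  have "I 0 (hsd_input K T c \<alpha>)"
    using input_ok_hsd_input by (simp add: I_def) (simp add: hsd_input_def)
  then have "exec goal_loop (hsd_input K T c \<alpha>) (K * 30 + 10) (I K)"
    unfolding goal_loop_def
  proof (rule exec_Loop[where I = I and B = 20, rotated 2])
    fix i s assume "i < K" "I i s"
    then show "bval (NLess (NVar ''i'') (NVar ''K'')) s \<and> exec goal_body s 20 (I (Suc i))"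
      by (intro conjI exec_loop_free) (simp_all add: I_def input_ok_def goal_body_def upd_simps)
  qed (auto simp: I_def input_ok_def)
  then show ?thesis
  proof (rule exec_Seq)
    fix s assume "I K s"
    then show "exec (NSet ''t'' (NConst 1)) s 10 (ready 0)"
      by (intro exec_loop_free)
        (simp_all add: I_def ready_def at_node_def tables_def input_ok_def goal_def model_def param_def upd_simps)
  qed simp
qed

end

lemma (in hsd_optimum) exec_output:
  assumes "snd s ''D'' = d" "fst s ''pi'' = q" "fst s ''len'' = l" "fst s ''N'' 0 = goal"
    and "tables (Suc goal) s"
  shows "exec (Seq output_init output_loop) s (100 * (K + 1)) (hsd_solved K T c \<alpha>)"
proof -
  define m where "m = l goal"
  \<comment> \<open>\<open>v\<close> counts the entries written. The cursor \<open>q\<close> is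
    constrained only while entries remain: after the last step it holds a meaningless predecessor of
    \<open>chain 0\<close>.\<close>
  define I where "I v s \<longleftrightarrow> fst s ''pi'' = q \<and> tables (Suc goal) s \<and> fst s ''m'' 0 = m \<and>
     snd s ''L'' 0 = d goal \<and> fst s ''i'' 0 = m + 1 - v \<and> (v \<le> m \<longrightarrow> fst s ''q'' 0 = chain (m - v)) \<and>
     (\<forall>w\<le>m. m + 1 - v \<le> w \<longrightarrow> fst s ''sigma'' w = model (chain w) \<and> fst s ''tau'' w = param (chain w))"
    for v and s :: state
  have init: "exec output_init s 30 (I 0)"
    using assms
    by (intro exec_loop_free) (simp_all add: output_init_def I_def tables_def m_def chain_goal upd_simps)
  have loop: "exec output_loop s' ((m + 1) * 60 + 10) (I (m + 1))" if "I 0 s'" for s'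
    unfolding output_loop_def
  proof (rule exec_Loop[where I = I and B = 50, OF _ _ that])
    fix v s' assume v: "v < m + 1" and I: "I v s'"
    have c: "chain (m - v) < Suc goal"
      using chain_props[of "m - v"] by (simp add: m_def less_Suc_eq_le)
    have q: "q (chain (m - v)) = chain (m - Suc v)" if "Suc v \<le> m"
      using that chain_pred[of "m - Suc v"] by (simp add: m_def Suc_diff_Suc)
    have w: "m - v \<le> w \<longleftrightarrow> w = m - v \<or> Suc m - v \<le> w" for w
      using v by linarith
    have "I (Suc v) (effect output_body s')"
      using v I c by (simp add: I_def tables_def output_body_def upd_simps q w)
    then show "bval (NLess (NConst 0) (NVar ''i'')) s' \<and> exec output_body s' 50 (I (Suc v))"
      using v I by (intro conjI exec_loop_free) (simp_all add: I_def output_body_def)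
  qed (auto simp: I_def)
  have "m \<le> K" using length_le[of goal] by (simp add: m_def model_goal)
  then have "exec (Seq output_init output_loop) s (100 * (K + 1)) (I (m + 1))"
    by (intro exec_Seq[OF init loop]) simp_all
  then show ?thesis
  proof (rule exec_weaken)
    fix s' assume "I (m + 1) s'"
    then have "out_hierarchy s' = chain_hierarchy" "out_latency s' = d goal"
      by (simp_all add: I_def out_hierarchy_def chain_hierarchy_def out_latency_def m_def Let_def)
    then show "hsd_solved K T c \<alpha> s'"
      using chain_hierarchy_minimal by (simp add: hsd_solved_def latency_chain)
  qed simp
qed

lemma (in hsd) exec_hsd_prog:
  "exec hsd_prog (hsd_input K T c \<alpha>) (5000 * (T ^ 4 * K ^ 2)) (hsd_solved K T c \<alpha>)"
proof -
  have finish: "exec (Seq output_init output_loop) s (100 * (K + 1)) (hsd_solved K T c \<alpha>)"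
    if "ready (Suc goal) s" for s
  proof -
    interpret hsd_optimum K T c \<alpha> "snd s ''D''" "fst s ''pi''" "fst s ''len''"
      by unfold_locales (use that in \<open>simp add: ready_def at_node_def optimal_at_def less_Suc_eq_le\<close>)
    show ?thesis
      by (rule exec_output) (use that in \<open>simp_all add: ready_def at_node_def\<close>)
  qed
  let ?B = "(goal + 1) * (goal * (900 * T ^ 2) + 400)"
  have "exec (Seq node_loop (Seq output_init output_loop)) s (?B + 100 * (K + 1)) (hsd_solved K T c \<alpha>)"
    if "ready 0 s" for s
    by (rule exec_Seq[OF exec_node_loop[OF that] finish]) simp_all
  then have "exec hsd_prog (hsd_input K T c \<alpha>) (K * 30 + 20 + (?B + 100 * (K + 1))) (hsd_solved K T c \<alpha>)"
    unfolding hsd_prog_def by (rule exec_Seq[OF exec_goal_loop]) simp_all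
  moreover have "K * 30 + 20 + (?B + 100 * (K + 1)) \<le> 5000 * (T ^ 4 * K ^ 2)"
  proof -
    have pos: "1 \<le> goal" "1 \<le> T ^ 2" "1 \<le> goal * T ^ 2" using goal_pos T_pos by simp_all
    \<comment> \<open>\<open>goal + 1\<close> is at most \<open>2 * goal\<close>, and the additive
      400 is absorbed because \<open>goal * T ^ 2\<close> is at least 1.\<close>
    have "?B \<le> (2 * goal) * (1300 * (goal * T ^ 2))"
      using pos by (intro mult_mono) auto
    also have "\<dots> = 2600 * (T ^ 4 * K ^ 2)"
      by (simp add: goal_def power2_eq_square power4_eq_xxxx)
    finally have "?B \<le> 2600 * (T ^ 4 * K ^ 2)" .
    moreover have "K * 1 \<le> K ^ 2 * T ^ 4"
      using K_pos T_pos by (intro mult_mono) (auto simp: power2_eq_square)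
    ultimately show ?thesis using K_pos by (simp add: mult.commute)
  qed
  ultimately show ?thesis by (rule exec_weaken)
qed

theorem theorem3p8:
  shows "\<exists>(P :: com) (C :: real). \<forall>(K :: nat) (Tmax :: nat) (c :: nat \<Rightarrow> real) (\<alpha> :: nat \<Rightarrow> nat \<Rightarrow> real).
    hsd_instance K Tmax c \<alpha> \<longrightarrow>
    (\<exists>n s. runs P (hsd_input K Tmax c \<alpha>) n s \<and> hsd_solved K Tmax c \<alpha> s \<and>
           real n \<le> C * (real Tmax ^ 4 * real K ^ 4 * ln (real (max 2 (Tmax * K)))))"
proof (rule exI[of _ hsd_prog], rule exI[of _ "5000 / ln 2"], intro allI impI)
  fix K T :: nat and c \<alpha>
  assume "hsd_instance K T c \<alpha>"
  then interpret hsd K T c \<alpha> by unfold_locales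
  obtain n s where run: "runs hsd_prog (hsd_input K T c \<alpha>) n s" "hsd_solved K T c \<alpha> s"
    and n: "n \<le> 5000 * (T ^ 4 * K ^ 2)"
    using exec_hsd_prog unfolding exec_def by blast
  have "T ^ 4 * K ^ 2 \<le> T ^ 4 * K ^ 4"
    using K_pos by (intro mult_left_mono power_increasing) auto
  with n have "n \<le> 5000 * (T ^ 4 * K ^ 4)" by linarith
  then have "real n \<le> real (5000 * (T ^ 4 * K ^ 4))" by (simp only: of_nat_le_iff)
  also have "\<dots> = 5000 * (real T ^ 4 * real K ^ 4)" by simp
  \<comment> \<open>The argument of the logarithm is at least 2, so the logarithm is at least
    \<open>ln 2\<close>; this is the origin of the constant \<open>5000 / ln 2\<close>.\<close>
  also have "\<dots> = 5000 / ln 2 * (real T ^ 4 * real K ^ 4 * ln 2)"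
    by simp
  also have "\<dots> \<le> 5000 / ln 2 * (real T ^ 4 * real K ^ 4 * ln (real (max 2 (T * K))))"
    by (intro mult_left_mono) auto
  finally show "\<exists>n s. runs hsd_prog (hsd_input K T c \<alpha>) n s \<and> hsd_solved K T c \<alpha> s \<and>
      real n \<le> 5000 / ln 2 * (real T ^ 4 * real K ^ 4 * ln (real (max 2 (T * K))))"
    using run by blast
qed

end
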